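(* For $n\ge1$ and $0\le p\le n-1$ let $K_{n,p}$ be the number of configurations of size $n$ in which exactly $p$ other pairs cross the given pair, and let $\mathcal K_n(p)=K_{n,p}/(n\,(2n-1)!!)$ (the probability of this event when all configurations are equally likely). Define the asymptotic distribution $\mathcal K(x)=\lim_{n\to\infty}(n-1)\,\mathcal K_n\bigl((n-1)x\bigr)$ for $x=\lim_{n\to\infty}p/(n-1)\in[0,1]$. Then $$\mathcal K(x)=\begin{cases}1/\sqrt{1-2x}, & 0\le x<1/2,\\ 0, & 1/2\le x\le 1.\end{cases}$$
   Context: Fix $n\ge1$. A configuration (of size $n$) is a perfect matching of the $2n$ points $1,2,\dots,2n$ (laid out on a line) into $n$ unordered pairs, together with one distinguished pair, called the given pair; the other $n-1$ pairs are treated as indistinguishable, so there are $n\,(2n-1)!!$ configurations. Let the given pair be $\{g<h\}$ and let $\{a<b\}$ be another pair. The pair $\{a,b\}$ crosses the given pair if exactly one of $a,b$ lies strictly between $g$ and $h$.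
   Formalization: At x=1/2 the claim fails: for p=(n-1)/2 (rounded) the quantity (n-1)K_n(p) grows like n^(1/4). There the value 0 is proved only for sequences p with p >= (n-1)/2+(n-1)^c eventually, for some c>1/2; every other x in [0,1] is covered in full. *)

theory Defs
  imports "HOL-Analysis.Analysis" "HOL-Library.Disjoint_Sets"
begin

definition perfect_matchings :: "nat \<Rightarrow> nat set set set" where
  "perfect_matchings n = {M. partition_on {1..2 * n} M \<and> (\<forall>e\<in>M. card e = 2)}"

(* A configuration (M, e) is a perfect matching M with the given pair e; the pairs of M carry
   no labels, so the other pairs are indistinguishable. *)
definition configurations :: "nat \<Rightarrow> (nat set set \<times> nat set) set" where
  "configurations n = {(M, e). M \<in> perfect_matchings n \<and> e \<in> M}"

(* For e = {g < h} we have Min e = g and Max e = h. *)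
definition crosses :: "nat set \<Rightarrow> nat set \<Rightarrow> bool" where
  "crosses f e \<longleftrightarrow> card {a \<in> f. Min e < a \<and> a < Max e} = 1"

definition K_count :: "nat \<Rightarrow> nat \<Rightarrow> nat" where
  "K_count n p =
     card {(M, e) \<in> configurations n. card {f \<in> M - {e}. crosses f e} = p}"

(* The product is (2n - 1)!!. *)
definition K_prob :: "nat \<Rightarrow> nat \<Rightarrow> real" where
  "K_prob n p = real (K_count n p) / (real n * (\<Prod>k=1..n. 2 * real k - 1))"

end

(* Condition on the given pair, with d points between its ends. Removing the partner of one point at a
   time shows that the number of ways to match the other 2m points (m = n - 1) with p crossing
   pairs depends only on d and 2m - d, and has a closed form.  Expanding these factorials as Beta
   integrals and summing over d gives
     K_n(p) = int_0^1 C(m,p) u^p (1-u)^(m-p) dt   with  u = 2t(1-t),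
   a mixture of binomial probabilities.  By Hoeffding's inequality the integrand is concentrated
   at u = p/m -> x.  For x < 1/2 replace the weight 1 by |1-2t| / sqrt(1-2x), which is close to 1
   near u = x because (1-2t)^2 = 1-2u; as |du| = 2 |1-2t| dt, what remains is
   int_0^(1/2) C(m,p) u^p (1-u)^(m-p) du ~ 1/m.  For x >= 1/2 the integrand is o(1/m)
   uniformly, since u <= 1/2 throughout while p/m >= 1/2 + m^(c-1) with c > 1/2. *)

theory Submission
  imports Defs "HOL-Probability.Hoeffding" "HOL-Real_Asymp.Real_Asymp"
begin

subsection \<open>Counting matchings by crossings\<close>

text \<open>An arbitrary ground set is allowed because the counting recursion deletes pairs, after
  which the remaining points no longer form an initial segment.\<close>

definition matchings :: "'a set \<Rightarrow> 'a set set set" where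
  "matchings S = {M. partition_on S M \<and> (\<forall>e\<in>M. card e = 2)}"

text \<open>\<open>A\<close> stands for the points strictly between the ends of the given pair; it
  stays fixed while the ground set shrinks.\<close>

definition crossings :: "'a set \<Rightarrow> 'a set set \<Rightarrow> nat" where
  "crossings A M = card {f \<in> M. card (f \<inter> A) = 1}"

text \<open>
  Choose the \<open>p\<close> crossing points on each of the two sides of sizes \<open>a\<close> and \<open>b\<close>, match them in
  \<open>p!\<close> ways, and match the rest within each side. Real-valued to allow division.
\<close>

definition crossing_number :: "nat \<Rightarrow> nat \<Rightarrow> nat \<Rightarrow> real" where
  "crossing_number a b p =
     (if p \<le> a \<and> p \<le> b \<and> even (a + p) \<and> even (b + p)
      then fact a * fact b /
        (fact p * 2 ^ ((a - p) div 2 + (b - p) div 2) * fact ((a - p) div 2) * fact ((b - p) div 2))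
      else 0)"

section \<open>Recurrence for the closed form\<close>

lemma crossing_number_eq:
  "crossing_number (p + 2 * k) (p + 2 * l) p =
     fact (p + 2 * k) * fact (p + 2 * l) / (fact p * 2 ^ (k + l) * fact k * fact l)"
  by (simp add: crossing_number_def)

text \<open>In the nonzero case \<open>k\<close> and \<open>l\<close> are the numbers of pairs lying
  within each side; with them the formula is free of \<open>div\<close> and truncated
  subtraction.\<close>

lemma crossing_number_cases:
  obtains (parity) k l where "a = p + 2 * k" "b = p + 2 * l"
  | (zero) "\<not> (p \<le> a \<and> p \<le> b \<and> even (a + p) \<and> even (b + p))" "crossing_number a b p = 0"
proof (cases "p \<le> a \<and> p \<le> b \<and> even (a + p) \<and> even (b + p)")
  case True
  then have "a = p + 2 * ((a - p) div 2)" "b = p + 2 * ((b - p) div 2)"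
    by auto
  then show ?thesis using parity by blast
next
  case False
  then show ?thesis using zero by (auto simp: crossing_number_def)
qed

lemma crossing_number_commute: "crossing_number a b p = crossing_number b a p"
  by (auto simp: crossing_number_def add.commute mult.commute mult.left_commute)

text \<open>Match one point of the first side: either with one of the \<open>a\<close> others there,
  or with one of the \<open>b\<close> points across, which uses up one crossing. Algebraically, with
  \<open>Suc a = p + 2 * k\<close>, the two terms are the shares \<open>2 * k\<close> and
  \<open>p\<close> of the factor \<open>Suc a\<close>.\<close>

lemma crossing_number_Suc:
  "crossing_number (Suc a) b p =
     real a * crossing_number (a - 1) b p
     + (if p = 0 then 0 else real b * crossing_number a (b - 1) (p - 1))"
proof (cases rule: crossing_number_cases[of "Suc a" p b])
  case (parity k l)
  have I: "real a * crossing_number (a - 1) b p =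
      2 * real k * fact a * fact b / (fact p * 2 ^ (k + l) * fact k * fact l)"
  proof (cases k)
    case 0
    then have "a = 0 \<or> \<not> p \<le> a - 1" using parity by auto
    with 0 show ?thesis by (auto simp: crossing_number_def)
  next
    case (Suc k')
    then have a: "a = Suc (p + 2 * k')" using parity by auto
    have "real (Suc n) * (u * v / (w * 2 ^ (k' + l) * s * t)) =
        2 * real (Suc k') * (real (Suc n) * u) * v / (w * 2 ^ (Suc k' + l) * (real (Suc k') * s) * t)"
      for u v w s t :: real and n by (simp add: divide_simps)
    then show ?thesis
      unfolding a parity(2) Suc fact_Suc
      by (simp only: crossing_number_eq diff_Suc_1)
  qed
  have II: "(if p = 0 then 0 else real b * crossing_number a (b - 1) (p - 1)) =
      real p * fact a * fact b / (fact p * 2 ^ (k + l) * fact k * fact l)"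
  proof (cases p)
    case (Suc q)
    then have a: "a = q + 2 * k" and b: "b = Suc (q + 2 * l)" using parity by auto
    have "real (Suc n) * (u * v / (w * x * s * t)) =
        real (Suc q) * u * (real (Suc n) * v) / (real (Suc q) * w * x * s * t)"
      for u v w x s t :: real and n by (simp add: divide_simps)
    then show ?thesis
      unfolding a b Suc fact_Suc
      by (simp only: crossing_number_eq diff_Suc_1 nat.distinct if_False)
  qed simp
  have "crossing_number (Suc a) b p =
      (2 * real k + real p) * fact a * fact b / (fact p * 2 ^ (k + l) * fact k * fact l)"
  proof -
    have "fact (Suc a) = (2 * real k + real p) * fact a"
    proof -
      have "real (Suc a) = 2 * real k + real p" using parity(1) by linarith
      then show ?thesis by (simp only: fact_Suc)
    qed
    then show ?thesis
      using crossing_number_eq[of p k l] parity by metis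
  qed
  then show ?thesis unfolding I II by (simp add: add_divide_distrib distrib_right)
next
  case zero
  have "real a * crossing_number (a - 1) b p = 0"
    using zero(1) by (cases a) (auto simp: crossing_number_def)
  moreover have "p = 0 \<or> real b * crossing_number a (b - 1) (p - 1) = 0"
    using zero(1) by (cases p; cases b) (auto simp: crossing_number_def)
  ultimately show ?thesis using zero(2) by auto
qed

text \<open>By symmetry the recurrence also removes a point of the second side; when the first side
  is empty, the crossing term has the factor 0.\<close>

lemma crossing_number_0_Suc:
  "crossing_number 0 (Suc b) p = real b * crossing_number 0 (b - 1) p"
  using crossing_number_Suc[of b 0 p] by (simp add: crossing_number_commute)

section \<open>Matchings and the removal of a pair\<close>

lemma matchings_empty [simp]: "matchings {} = {{}}"
  by (auto simp: matchings_def partition_on_def)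

lemma finite_matchings [simp]: "finite S \<Longrightarrow> finite (matchings S)"
  by (rule finite_subset[of _ "Pow (Pow S)"]) (auto simp: matchings_def partition_on_def)

lemma insert_in_matchings:
  assumes "M \<in> matchings (S - e)" "e \<subseteq> S" "card e = 2"
  shows "insert e M \<in> matchings S" "e \<notin> M"
proof -
  have "e \<noteq> {}" using assms by auto
  then show "e \<notin> M" using assms by (auto simp: matchings_def partition_on_def)
  show "insert e M \<in> matchings S"
    using assms \<open>e \<noteq> {}\<close>
    by (auto simp: matchings_def partition_on_def pairwise_insert disjnt_def disjoint_def)
qed

lemma remove_in_matchings:
  assumes "M \<in> matchings S" "e \<in> M"
  shows "M - {e} \<in> matchings (S - e)"
proof -
  have disj: "f \<inter> e = {}" if "f \<in> M" "f \<noteq> e" for f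
    using assms that by (auto simp: matchings_def partition_on_def disjoint_def)
  have "\<Union> (M - {e}) = \<Union> M - e"
    using disj assms(2) by blast
  moreover have "pairwise disjnt (M - {e})"
    using assms(1) by (auto simp: matchings_def partition_on_def intro: pairwise_subset)
  ultimately show ?thesis
    using assms(1) by (simp add: matchings_def partition_on_def)
qed

text \<open>Inserting and deleting \<open>e\<close> are inverse bijections; the predicate
  \<open>Q\<close> lets the crossing condition be carried along.\<close>

lemma card_matchings_containing:
  assumes "e \<subseteq> S" "card e = 2"
  shows "card {M \<in> matchings S. e \<in> M \<and> Q M} = card {M \<in> matchings (S - e). Q (insert e M)}"
proof -
  have "bij_betw (insert e) {M \<in> matchings (S - e). Q (insert e M)} {M \<in> matchings S. e \<in> M \<and> Q M}"
  proof (rule bij_betw_byWitness[where f' = "\<lambda>M. M - {e}"])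
    show "\<forall>M\<in>{M \<in> matchings (S - e). Q (insert e M)}. insert e M - {e} = M"
      using insert_in_matchings(2)[OF _ assms] by auto
    show "insert e ` {M \<in> matchings (S - e). Q (insert e M)} \<subseteq> {M \<in> matchings S. e \<in> M \<and> Q M}"
      using insert_in_matchings(1)[OF _ assms] by auto
  qed (auto simp: insert_absorb remove_in_matchings)
  from bij_betw_same_card[OF this] show ?thesis by simp
qed

text \<open>Classify by the partner \<open>y\<close> of the fixed point \<open>x\<close>. The
  classes are disjoint since two distinct blocks cannot both contain \<open>x\<close>.\<close>

lemma card_matchings_split:
  assumes "finite S" "x \<in> S"
  shows "card {M \<in> matchings S. Q M} =
    (\<Sum>y\<in>S - {x}. card {M \<in> matchings (S - {x, y}). Q (insert {x, y} M)})"
proof -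
  have eq: "{M \<in> matchings S. Q M} = (\<Union>y\<in>S - {x}. {M \<in> matchings S. {x, y} \<in> M \<and> Q M})"
  proof -
    have "\<exists>y\<in>S - {x}. {x, y} \<in> M" if "M \<in> matchings S" for M
    proof -
      from that assms obtain e where e: "e \<in> M" "x \<in> e" "e \<subseteq> S" "card e = 2"
        unfolding matchings_def partition_on_def by auto
      then obtain y where "e = {x, y}" "y \<noteq> x"
        by (metis card_2_iff doubleton_eq_iff insertE singletonD)
      with e show ?thesis by auto
    qed
    then show ?thesis by blast
  qed
  have disj: "{M \<in> matchings S. {x, y} \<in> M \<and> Q M} \<inter> {M \<in> matchings S. {x, z} \<in> M \<and> Q M} = {}"
    if "y \<noteq> z" "y \<in> S - {x}" "z \<in> S - {x}" for y z
  proof -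
    have "{x, y} \<noteq> {x, z}" "\<not> disjnt {x, y} {x, z}"
      using that by (auto simp: doubleton_eq_iff disjnt_def)
    then show ?thesis
      by (fastforce simp: matchings_def partition_on_def dest: pairwiseD)
  qed
  have "card {M \<in> matchings S. Q M} = (\<Sum>y\<in>S - {x}. card {M \<in> matchings S. {x, y} \<in> M \<and> Q M})"
    unfolding eq by (rule card_UN_disjoint) (use assms disj in auto)
  also have "\<dots> = (\<Sum>y\<in>S - {x}. card {M \<in> matchings (S - {x, y}). Q (insert {x, y} M)})"
    using assms by (intro sum.cong refl card_matchings_containing) auto
  finally show ?thesis .
qed

lemma crossings_insert:
  assumes "M \<in> matchings (S - e)" "finite S" "e \<subseteq> S" "card e = 2"
  shows "crossings A (insert e M) = (if card (e \<inter> A) = 1 then 1 else 0) + crossings A M"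
proof -
  have "finite M"
    using assms finite_elements[of "S - e" M] by (auto simp: matchings_def)
  moreover have "{f \<in> insert e M. card (f \<inter> A) = 1} =
      (if card (e \<inter> A) = 1 then insert e {f \<in> M. card (f \<inter> A) = 1} else {f \<in> M. card (f \<inter> A) = 1})"
    by auto
  ultimately show ?thesis
    using insert_in_matchings(2)[OF assms(1,3,4)] by (simp add: crossings_def)
qed

text \<open>Strong induction on the size of \<open>S\<close>, removing one point with its partner.
  The point is taken in \<open>A\<close> as long as there is one, so that the count obeys
  \<open>crossing_number_Suc\<close>; afterwards \<open>crossing_number_0_Suc\<close> takes
  over.\<close>

lemma card_matchings_crossings:
  assumes "finite S"
  shows "real (card {M \<in> matchings S. crossings A M = p}) =
    crossing_number (card (S \<inter> A)) (card (S - A)) p"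
  using assms
proof (induction "card S" arbitrary: S p rule: less_induct)
  case less
  \<comment> \<open>The pair \<open>{x, y}\<close> is itself a crossing iff exactly one end lies in
    \<open>A\<close>. Then \<open>p - 1\<close> crossings remain, and \<open>p = 0\<close> is
    impossible, hence the separate branch.\<close>
  have split: "real (card {M \<in> matchings S. crossings A M = p}) =
    (\<Sum>y\<in>S - {x}. if card ({x, y} \<inter> A) = 1
       then (if p = 0 then 0 else
         crossing_number (card ((S - {x,y}) \<inter> A)) (card (S - {x,y} - A)) (p - 1))
       else crossing_number (card ((S - {x,y}) \<inter> A)) (card (S - {x,y} - A)) p)" if x: "x \<in> S" for x
    unfolding card_matchings_split[OF less.prems x] of_nat_sum
  proof (rule sum.cong)
    fix y assume y: "y \<in> S - {x}"
    have e: "{x, y} \<subseteq> S" "card {x, y} = 2" using x y by auto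
    have IH: "real (card {M \<in> matchings (S - {x, y}). crossings A M = q}) =
      crossing_number (card ((S - {x,y}) \<inter> A)) (card (S - {x,y} - A)) q" for q
      using x y less.prems by (intro less.hyps psubset_card_mono) auto
    have "{M \<in> matchings (S - {x, y}). crossings A (insert {x, y} M) = p} =
       (if card ({x, y} \<inter> A) = 1
       then (if p = 0 then {} else {M \<in> matchings (S - {x, y}). crossings A M = p - 1})
       else {M \<in> matchings (S - {x, y}). crossings A M = p})"
      using crossings_insert[OF _ less.prems e] by auto
    then show "real (card {M \<in> matchings (S - {x, y}). crossings A (insert {x, y} M) = p}) =
      (if card ({x, y} \<inter> A) = 1
       then (if p = 0 then 0 else
         crossing_number (card ((S - {x,y}) \<inter> A)) (card (S - {x,y} - A)) (p - 1))
       else crossing_number (card ((S - {x,y}) \<inter> A)) (card (S - {x,y} - A)) p)"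
      by (simp add: IH)
  qed simp
  show ?case
  proof (cases "S \<inter> A = {}")
    case True
    show ?thesis
    proof (cases "S = {}")
      case True
      have "{M \<in> matchings {}. crossings A M = p} = (if p = 0 then {{}} else {})"
        by (auto simp: crossings_def)
      with True show ?thesis by (simp add: crossing_number_def)
    next
      case False
      then obtain x where x: "x \<in> S" by blast
      obtain b where b: "card S = Suc b" using x less.prems by (cases "card S") auto
      have SA: "S - A = S" using True by auto
      have "real (card {M \<in> matchings S. crossings A M = p}) =
        (\<Sum>y\<in>S - {x}. crossing_number 0 (b - 1) p)"
        unfolding split[OF x]
      proof (rule sum.cong)
        fix y assume y: "y \<in> S - {x}"
        have "{x, y} \<inter> A = {}" "(S - {x, y}) \<inter> A = {}" "S - {x, y} - A = S - {x, y}"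
          using True x y by auto
        moreover have "card (S - {x, y}) = b - 1"
          using x y less.prems b by (auto simp: card_Diff_subset card_insert_if)
        ultimately show "(if card ({x, y} \<inter> A) = 1
       then (if p = 0 then 0 else
         crossing_number (card ((S - {x,y}) \<inter> A)) (card (S - {x,y} - A)) (p - 1))
       else crossing_number (card ((S - {x,y}) \<inter> A)) (card (S - {x,y} - A)) p) =
       crossing_number 0 (b - 1) p" by simp
      qed simp
      also have "\<dots> = crossing_number 0 (Suc b) p"
        using x b less.prems by (simp add: crossing_number_0_Suc)
      finally show ?thesis using True SA b by simp
    qed
  next
    case False
    then obtain x where x: "x \<in> S" "x \<in> A" by blast
    obtain a where a: "card (S \<inter> A) = Suc a" using x less.prems by (cases "card (S \<inter> A)") auto
    define b where "b = card (S - A)"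
    have eq: "S - {x} = (S \<inter> A - {x}) \<union> (S - A)" using x by auto
    have "real (card {M \<in> matchings S. crossings A M = p}) =
        (\<Sum>y\<in>S \<inter> A - {x}. crossing_number (a - 1) b p) +
        (\<Sum>y\<in>S - A. if p = 0 then 0 else crossing_number a (b - 1) (p - 1))"
      unfolding split[OF x(1)] unfolding eq
    \<comment> \<open>The first three goals are finiteness and disjointness; the fourth compares the
      two sums, for partners inside and outside \<open>A\<close>.\<close>
    proof (subst sum.union_disjoint, goal_cases)
      case 4
      show ?case
      proof (intro arg_cong2[of _ _ _ _ "(+)"] sum.cong refl, goal_cases)
        case (1 y)
        have "{x, y} \<inter> A = {x, y}" "(S - {x, y}) \<inter> A = S \<inter> A - {x, y}" "S - {x, y} - A = S - A"
          using x 1 by auto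
        moreover have "card (S \<inter> A - {x, y}) = a - 1"
          using x 1 less.prems a by (auto simp: card_Diff_subset card_insert_if)
        moreover have "card {x, y} \<noteq> 1" using 1 by auto
        ultimately show ?case by (simp add: b_def)
      next
        case (2 y)
        have "{x, y} \<inter> A = {x}" "(S - {x, y}) \<inter> A = S \<inter> A - {x}" "S - {x, y} - A = S - A - {y}"
          using x 2 by auto
        moreover have "card (S \<inter> A - {x}) = a"
          using x 2 less.prems a by (simp add: card_Diff_subset)
        moreover have "card (S - A - {y}) = b - 1"
          using x 2 less.prems by (simp add: b_def)
        ultimately show ?case by simp
      qed
    qed (use less.prems in auto)
    also have "\<dots> = crossing_number (Suc a) b p"
      using x a less.prems by (simp add: crossing_number_Suc b_def)
    finally show ?thesis using a b_def by simp
  qed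
qed

section \<open>Configurations counted by their given pair\<close>

text \<open>Choose the given pair first and then match the remaining points; crossing it means
  meeting the open interval between its ends in exactly one point.\<close>

lemma K_count_eq_sum:
  "K_count n p = (\<Sum>e | e \<subseteq> {1..2 * n} \<and> card e = 2.
     card {M \<in> matchings ({1..2 * n} - e). crossings {Min e<..<Max e} M = p})"
proof -
  let ?S = "{1..2 * n}"
  let ?E = "{e. e \<subseteq> ?S \<and> card e = 2}"
  let ?Q = "\<lambda>e M. crossings {Min e<..<Max e} (M - {e}) = p"
  have fin: "finite ?E" by (rule finite_subset[of _ "Pow ?S"]) auto
  have cr: "card {f \<in> M - {e}. crosses f e} = crossings {Min e<..<Max e} (M - {e})" for M e
    by (simp add: crossings_def crosses_def Int_def)
  have "(M, e) \<in> configurations n \<longleftrightarrow> e \<in> ?E \<and> M \<in> matchings ?S \<and> e \<in> M" for M e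
    by (auto simp: configurations_def perfect_matchings_def matchings_def partition_on_def)
  then have "{(M, e) \<in> configurations n. card {f \<in> M - {e}. crosses f e} = p} =
      prod.swap ` (SIGMA e:?E. {M \<in> matchings ?S. e \<in> M \<and> ?Q e M})"
    unfolding cr by (auto simp: image_iff)
  then have "K_count n p = card (SIGMA e:?E. {M \<in> matchings ?S. e \<in> M \<and> ?Q e M})"
    unfolding K_count_def by (simp add: card_image)
  also have "\<dots> = (\<Sum>e\<in>?E. card {M \<in> matchings ?S. e \<in> M \<and> ?Q e M})"
    using fin by simp
  also have "\<dots> = (\<Sum>e\<in>?E. card {M \<in> matchings (?S - e). crossings {Min e<..<Max e} M = p})"
  proof (rule sum.cong)
    fix e assume e: "e \<in> ?E"
    have "{M \<in> matchings (?S - e). ?Q e (insert e M)} =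
        {M \<in> matchings (?S - e). crossings {Min e<..<Max e} M = p}"
      using e insert_in_matchings(2)[of _ ?S e] by auto
    then show "card {M \<in> matchings ?S. e \<in> M \<and> ?Q e M} =
        card {M \<in> matchings (?S - e). crossings {Min e<..<Max e} M = p}"
      using e card_matchings_containing[of e ?S "?Q e"] by simp
  qed simp
  finally show ?thesis .
qed

text \<open>A pair is coded by the number \<open>d\<close> of points strictly between its ends and
  the number \<open>i\<close> of points before it.\<close>

lemma bij_betw_gap_pairs:
  "bij_betw (\<lambda>(d, i). {Suc i, i + d + 2}) (SIGMA d:{..2 * m}. {..<2 * m + 1 - d})
     {e. e \<subseteq> {1..2 * Suc m} \<and> card e = 2}"
  (is "bij_betw ?f ?D ?E")
proof (rule bij_betw_imageI)
  show "inj_on ?f ?D"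
    by (auto simp: inj_on_def doubleton_eq_iff)
  have "e \<in> ?f ` ?D" if e: "e \<in> ?E" for e
  proof -
    obtain g h where gh: "e = {g, h}" "g < h"
      using e by (metis (mono_tags, lifting) card_2_iff insert_commute
          linorder_neqE_nat mem_Collect_eq)
    then have "g \<ge> 1" "h \<le> 2 * Suc m" using e by auto
    then have "(h - g - 1, g - 1) \<in> ?D" "e = ?f (h - g - 1, g - 1)"
      using gh by auto
    then show ?thesis by (rule rev_image_eqI)
  qed
  moreover have "?f x \<in> ?E" if "x \<in> ?D" for x
    using that by (auto simp: card_insert_if)
  ultimately show "?f ` ?D = ?E" by blast
qed

text \<open>The \<open>d\<close> points inside the given pair and the \<open>2 * m - d\<close>
  outside are the two sides, so a pair's position enters only through the
  \<open>2 * m + 1 - d\<close> translates. The average of this weight and its mirror image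
  \<open>d + 1\<close> is \<open>m + 1\<close>.\<close>

lemma K_count_Suc:
  "real (K_count (Suc m) p) = real (Suc m) * (\<Sum>d\<le>2 * m. crossing_number d (2 * m - d) p)"
proof -
  let ?S = "{1..2 * Suc m}"
  let ?F = "\<lambda>d. crossing_number d (2 * m - d) p"
  let ?g = "\<lambda>e. real (card {M \<in> matchings (?S - e). crossings {Min e<..<Max e} M = p})"
  have g: "?g {Suc i, i + d + 2} = ?F d" if "d \<le> 2 * m" "i < 2 * m + 1 - d" for d i
  proof -
    have "Min {Suc i, i + d + 2} = Suc i" "Max {Suc i, i + d + 2} = i + d + 2" by auto
    moreover have I: "(?S - {Suc i, i + d + 2}) \<inter> {Suc i<..<i + d + 2} = {Suc i<..<i + d + 2}"
      using that by auto
    moreover have "?S - {Suc i, i + d + 2} - {Suc i<..<i + d + 2} = ?S - {Suc i..i + d + 2}"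
      by auto
    moreover have "card (?S - {Suc i..i + d + 2}) = 2 * m - d"
      using that by (subst card_Diff_subset) auto
    ultimately show ?thesis
      by (simp add: card_matchings_crossings del: mult_Suc_right mult_Suc)
  qed
  have "real (K_count (Suc m) p) = (\<Sum>e | e \<subseteq> ?S \<and> card e = 2. ?g e)"
    unfolding K_count_eq_sum of_nat_sum ..
  also have "\<dots> = (\<Sum>(d, i)\<in>(SIGMA d:{..2 * m}. {..<2 * m + 1 - d}). ?g {Suc i, i + d + 2})"
    by (subst sum.reindex_bij_betw[OF bij_betw_gap_pairs, symmetric]) (simp add: case_prod_unfold)
  also have "\<dots> = (\<Sum>(d, i)\<in>(SIGMA d:{..2 * m}. {..<2 * m + 1 - d}). ?F d)"
    using g by (intro sum.cong) auto
  also have "\<dots> = (\<Sum>d\<le>2 * m. \<Sum>i<2 * m + 1 - d. ?F d)"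
    by (subst sum.Sigma) auto
  also have "\<dots> = (\<Sum>d\<le>2 * m. real (2 * m + 1 - d) * ?F d)"
    by simp
  finally have 1: "real (K_count (Suc m) p) = (\<Sum>d\<le>2 * m. real (2 * m + 1 - d) * ?F d)" .
  \<comment> \<open>Exchanging the inside and the outside of the given pair; averaging the two sums makes the
    weights constant.\<close>
  also have "\<dots> = (\<Sum>d\<le>2 * m. real (d + 1) * ?F d)"
    by (rule sum.reindex_bij_witness[of _ "\<lambda>d. 2 * m - d" "\<lambda>d. 2 * m - d"])
       (auto simp: crossing_number_commute of_nat_diff)
  finally have "2 * real (K_count (Suc m) p) =
      (\<Sum>d\<le>2 * m. real (2 * m + 1 - d) * ?F d + real (d + 1) * ?F d)"
    using 1 by (simp add: sum.distrib)
  also have "\<dots> = (\<Sum>d\<le>2 * m. 2 * real (Suc m) * ?F d)"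
    by (rule sum.cong) (auto simp: of_nat_diff algebra_simps)
  also have "\<dots> = 2 * (real (Suc m) * (\<Sum>d\<le>2 * m. ?F d))"
    by (simp only: sum_distrib_left mult.assoc)
  finally show ?thesis by linarith
qed

text \<open>Only gaps \<open>d = p + 2 * k\<close> contribute, by parity and because each side must
  hold the \<open>p\<close> crossing ends.\<close>

lemma sum_crossing_number:
  assumes "p \<le> m"
  shows "(\<Sum>d\<le>2 * m. crossing_number d (2 * m - d) p) =
    (\<Sum>k\<le>m - p. crossing_number (p + 2 * k) (p + 2 * (m - p - k)) p)"
proof -
  let ?f = "\<lambda>k. p + 2 * k"
  have "(\<Sum>d\<le>2 * m. crossing_number d (2 * m - d) p) =
      (\<Sum>d\<in>?f ` {..m - p}. crossing_number d (2 * m - d) p)"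
  proof (rule sum.mono_neutral_right)
    show "\<forall>d\<in>{..2 * m} - ?f ` {..m - p}. crossing_number d (2 * m - d) p = 0"
    proof
      fix d assume d: "d \<in> {..2 * m} - ?f ` {..m - p}"
      show "crossing_number d (2 * m - d) p = 0"
      proof (cases rule: crossing_number_cases[of d p "2 * m - d"])
        case (parity k l)
        then have "k \<le> m - p" using d by auto
        with d parity(1) show ?thesis by blast
      qed
    qed
  qed (use assms in auto)
  also have "\<dots> = (\<Sum>k\<le>m - p. crossing_number (?f k) (2 * m - ?f k) p)"
    by (subst sum.reindex) (auto simp: inj_on_def)
  also have "\<dots> = (\<Sum>k\<le>m - p. crossing_number (p + 2 * k) (p + 2 * (m - p - k)) p)"
  proof (rule sum.cong)
    fix k assume "k \<in> {..m - p}"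
    then have "2 * m - ?f k = p + 2 * (m - p - k)" using assms by auto
    then show "crossing_number (?f k) (2 * m - ?f k) p =
        crossing_number (p + 2 * k) (p + 2 * (m - p - k)) p" by simp
  qed simp
  finally show ?thesis .
qed

text \<open>The even factors of \<open>fact (2 * m + 1)\<close> multiply to
  \<open>2 ^ m * fact m\<close>.\<close>

lemma prod_odd: "(\<Prod>k=1..Suc m. 2 * real k - 1) = fact (2 * m + 1) / (2 ^ m * fact m)"
proof (induction m)
  case (Suc m)
  have "(\<Prod>k=1..Suc (Suc m). 2 * real k - 1) = (2 * real m + 3) * (fact (2 * m + 1) / (2 ^ m * fact m))"
    using Suc by (simp add: algebra_simps)
  also have "\<dots> = fact (2 * Suc m + 1) / (2 ^ Suc m * fact (Suc m))"
  proof -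
    have "2 * Suc m + 1 = Suc (Suc (2 * m + 1))" by simp
    then have "(fact (2 * Suc m + 1) :: real) = (2 * real m + 3) * (2 * real (Suc m)) * fact (2 * m + 1)"
      by (simp only: fact_Suc) (simp add: algebra_simps)
    then show ?thesis
      unfolding fact_Suc[of m] power_Suc
      by (simp only:) (simp add: divide_simps)
  qed
  finally show ?case .
qed simp

text \<open>The factor \<open>Suc m\<close> of the count cancels against the number of choices of
  the given pair. The factorials are regrouped so that the last quotient is a value of the Beta
  function.\<close>

lemma K_prob_Suc:
  assumes "p \<le> m"
  shows "K_prob (Suc m) p =
    (\<Sum>k\<le>m - p. 2 ^ p * real (m choose p) * real (m - p choose k) *
       (fact (p + 2 * k) * fact (p + 2 * (m - p - k)) / fact (2 * m + 1)))"
proof -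
  have *: "crossing_number (p + 2 * k) (p + 2 * (m - p - k)) p * (2 ^ m * fact m) =
      2 ^ p * real (m choose p) * real (m - p choose k) *
       (fact (p + 2 * k) * fact (p + 2 * (m - p - k)))" if "k \<le> m - p" for k
  proof -
    have "(2::real) ^ m = 2 ^ p * 2 ^ (k + (m - p - k))"
      using that assms by (simp flip: power_add)
    then show ?thesis
      using that assms unfolding crossing_number_eq
      by (simp add: binomial_fact)
  qed
  have "K_prob (Suc m) p =
      (\<Sum>k\<le>m - p. crossing_number (p + 2 * k) (p + 2 * (m - p - k)) p * (2 ^ m * fact m)) / fact (2 * m + 1)"
    unfolding K_prob_def K_count_Suc prod_odd sum_crossing_number[OF assms]
    by (simp add: sum_distrib_right del: fact_Suc of_nat_Suc)
  then show ?thesis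
    using * by (simp add: sum_divide_distrib del: fact_Suc of_nat_Suc)
qed

subsection \<open>The integral representation\<close>

lemma has_integral_power_mult_power:
  "((\<lambda>t::real. t ^ a * (1 - t) ^ b) has_integral fact a * fact b / fact (a + b + 1)) {0..1}"
proof -
  have "((\<lambda>t. t powr (real (Suc a) - 1) * (1 - t) powr (real (Suc b) - 1))
          has_integral Beta (real (Suc a)) (real (Suc b))) {0..1}"
    by (rule has_integral_Beta_real) auto
  also have "Beta (real (Suc a)) (real (Suc b)) = fact a * fact b / fact (a + b + 1)"
  proof -
    have "real (Suc a) + real (Suc b) = 1 + real (a + b + 1)" by simp
    then show ?thesis
      unfolding Beta_def of_nat_Suc by (simp only: Gamma_fact)
  qed
  finally have "((\<lambda>t. t powr (real (Suc a) - 1) * (1 - t) powr (real (Suc b) - 1))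
      has_integral fact a * fact b / fact (a + b + 1)) (cbox 0 1)"
    by simp
  \<comment> \<open>Only the interior matters: at an endpoint \<open>0 powr 0 = 0\<close>, whereas
    \<open>0 ^ 0 = 1\<close>.\<close>
  then have "((\<lambda>t::real. t ^ a * (1 - t) ^ b) has_integral fact a * fact b / fact (a + b + 1)) (cbox 0 1)"
    by (rule has_integral_spike_interior) (auto simp: powr_realpow)
  then show ?thesis by simp
qed

section \<open>Binomial weights and their concentration\<close>

text \<open>The probability of \<open>p\<close> successes in \<open>m\<close> independent trials
  with success probability \<open>u\<close>.\<close>

definition binomial_weight :: "nat \<Rightarrow> nat \<Rightarrow> real \<Rightarrow> real" where
  "binomial_weight m p u = real (m choose p) * u ^ p * (1 - u) ^ (m - p)"

lemma continuous_on_binomial_weight [continuous_intros]: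
  "continuous_on S f \<Longrightarrow> continuous_on S (\<lambda>t. binomial_weight m p (f t))"
  unfolding binomial_weight_def by (intro continuous_intros)

lemma binomial_weight_nonneg: "0 \<le> u \<Longrightarrow> u \<le> 1 \<Longrightarrow> 0 \<le> binomial_weight m p u"
  by (simp add: binomial_weight_def)

text \<open>A Beta integral: a uniformly distributed success probability makes all
  \<open>m + 1\<close> numbers of successes equally likely.\<close>

lemma integral_binomial_weight:
  assumes "p \<le> m"
  shows "integral {0..1} (binomial_weight m p) = 1 / (real m + 1)"
proof -
  have "((\<lambda>u. real (m choose p) * (u ^ p * (1 - u) ^ (m - p))) has_integral
      real (m choose p) * (fact p * fact (m - p) / fact (p + (m - p) + 1))) {0..1}"
    by (intro has_integral_mult_right has_integral_power_mult_power)
  then have "(binomial_weight m p has_integral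
      real (m choose p) * (fact p * fact (m - p) / fact (m + 1))) {0..1}"
    using assms by (simp add: binomial_weight_def[abs_def] mult.assoc del: fact_Suc)
  moreover have "real (m choose p) * (fact p * fact (m - p) / fact (m + 1)) = 1 / (real m + 1)"
    using assms by (simp add: binomial_fact add.commute)
  ultimately show ?thesis by (simp add: integral_unique)
qed

text \<open>The single outcome \<open>p\<close> lies in the deviation event that Hoeffding's
  inequality bounds.\<close>

lemma binomial_weight_tail:
  assumes "0 < m" "p \<le> m" "0 \<le> u" "u \<le> 1" "0 \<le> \<delta>" "\<delta> \<le> \<bar>real p / real m - u\<bar>"
  shows "binomial_weight m p u \<le> 2 * exp (-2 * real m * \<delta>\<^sup>2)"
proof -
  interpret binomial_distribution m u
    by unfold_locales (use assms in auto)
  have "binomial_weight m p u = measure_pmf.prob (binomial_pmf m u) {p}"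
    using assms by (simp add: binomial_weight_def measure_pmf_single)
  also have "\<dots> \<le> measure_pmf.prob (binomial_pmf m u) {x. \<bar>real x / real m - u\<bar> \<ge> \<delta>}"
    by (intro measure_pmf.finite_measure_mono) (use assms in auto)
  also have "\<dots> \<le> 2 * exp (-2 * real m * \<delta>\<^sup>2)"
    using prob_abs_ge'[OF assms(1,5)] by simp
  finally show ?thesis .
qed

section \<open>The substitution u = 2t(1-t)\<close>

lemma two_t_one_minus_t:
  assumes "0 \<le> t" "t \<le> (1::real)"
  shows "0 \<le> 2 * t * (1 - t)" "2 * t * (1 - t) \<le> 1 / 2" "sqrt (1 - 2 * (2 * t * (1 - t))) = \<bar>1 - 2 * t\<bar>"
proof -
  have eq: "1 - 2 * (2 * t * (1 - t)) = (1 - 2 * t)\<^sup>2"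
    by (simp add: power2_eq_square algebra_simps)
  then show "sqrt (1 - 2 * (2 * t * (1 - t))) = \<bar>1 - 2 * t\<bar>" by simp
  show "2 * t * (1 - t) \<le> 1 / 2" using eq zero_le_power2[of "1 - 2 * t"] by linarith
  show "0 \<le> 2 * t * (1 - t)" using assms by simp
qed

text \<open>With u = 2t(1-t) one has |du| = 2 |1-2t| dt, and each half of the unit interval covers
  [0, 1/2] once, so each contributes half of the right-hand side.\<close>

lemma integral_abs_binomial_weight:
  "integral {0..1} (\<lambda>t. \<bar>1 - 2 * t\<bar> * binomial_weight m p (2 * t * (1 - t))) =
     integral {0..1/2} (binomial_weight m p)"
proof -
  define G where "G = (\<lambda>v. integral {0..v} (binomial_weight m p))"
  \<comment> \<open>Stated for any subinterval \<open>{a..b}\<close> of [0, 1], because it serves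
    both halves.\<close>
  have G: "((\<lambda>t. G (2 * t * (1 - t))) has_real_derivative
      binomial_weight m p (2 * t * (1 - t)) * (2 * (1 - 2 * t))) (at t within {a..b})"
    if "0 \<le> a" "b \<le> 1" "t \<in> {a..b}" for a b t
  proof -
    have "(G has_real_derivative binomial_weight m p (2 * t * (1 - t)))
        (at (2 * t * (1 - t)) within {0..1/2})"
      unfolding G_def
      by (rule integral_has_real_derivative)
        (use that two_t_one_minus_t[of t] in \<open>auto intro!: continuous_intros\<close>)
    moreover have "(\<lambda>t. 2 * t * (1 - t)) ` {a..b} \<subseteq> {0..1/2}"
      using two_t_one_minus_t that by fastforce
    ultimately have "(G has_real_derivative binomial_weight m p (2 * t * (1 - t)))
        (at (2 * t * (1 - t)) within (\<lambda>t. 2 * t * (1 - t)) ` {a..b})"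
      by (rule DERIV_subset)
    moreover have "((\<lambda>t. 2 * t * (1 - t)) has_real_derivative 2 * (1 - 2 * t)) (at t within {a..b})"
      by (auto intro!: derivative_eq_intros simp: algebra_simps)
    ultimately show ?thesis by (rule DERIV_image_chain[unfolded o_def])
  qed
  have 1: "((\<lambda>t. \<bar>1 - 2 * t\<bar> * binomial_weight m p (2 * t * (1 - t))) has_integral G (1/2) / 2) {0..1/2}"
  proof -
    have "((\<lambda>t. \<bar>1 - 2 * t\<bar> * binomial_weight m p (2 * t * (1 - t))) has_integral
        G (2 * (1/2) * (1 - 1/2)) / 2 - G (2 * 0 * (1 - 0)) / 2) {0..1/2}"
    proof (rule fundamental_theorem_of_calculus)
      fix t :: real assume t: "t \<in> {0..1/2}"
      show "((\<lambda>t. G (2 * t * (1 - t)) / 2) has_vector_derivative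
          \<bar>1 - 2 * t\<bar> * binomial_weight m p (2 * t * (1 - t))) (at t within {0..1/2})"
        unfolding has_real_derivative_iff_has_vector_derivative[symmetric]
        by (rule DERIV_cong[OF DERIV_cdivide[OF G]]) (use t in auto)
    qed simp
    then show ?thesis by (simp add: G_def)
  qed
  have 2: "((\<lambda>t. \<bar>1 - 2 * t\<bar> * binomial_weight m p (2 * t * (1 - t))) has_integral G (1/2) / 2) {1/2..1}"
  proof -
    \<comment> \<open>For t \<ge> 1/2 the factor 1-2t is nonpositive, so the antiderivative changes
      sign.\<close>
    have "((\<lambda>t. \<bar>1 - 2 * t\<bar> * binomial_weight m p (2 * t * (1 - t))) has_integral
        - G (2 * 1 * (1 - 1)) / 2 - - G (2 * (1/2) * (1 - 1/2)) / 2) {1/2..1}"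
    proof (rule fundamental_theorem_of_calculus)
      fix t :: real assume t: "t \<in> {1/2..1}"
      show "((\<lambda>t. - G (2 * t * (1 - t)) / 2) has_vector_derivative
          \<bar>1 - 2 * t\<bar> * binomial_weight m p (2 * t * (1 - t))) (at t within {1/2..1})"
        unfolding has_real_derivative_iff_has_vector_derivative[symmetric]
        by (rule DERIV_cong[OF DERIV_cdivide[OF DERIV_minus[OF G]]])
          (use t in \<open>auto simp: field_simps\<close>)
    qed simp
    then show ?thesis by (simp add: G_def)
  qed
  have "((\<lambda>t. \<bar>1 - 2 * t\<bar> * binomial_weight m p (2 * t * (1 - t))) has_integral G (1/2) / 2 + G (1/2) / 2) {0..1}"
    by (rule has_integral_combine[OF _ _ 1 2]) auto
  then show ?thesis by (simp add: integral_unique G_def)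
qed

text \<open>Heuristically, t is the proportion of points between the ends of the given pair, and
  2t(1-t) is the chance that two independent points are separated.\<close>

definition crossing_integral :: "nat \<Rightarrow> nat \<Rightarrow> real" where
  "crossing_integral m p = integral {0..1} (\<lambda>t. binomial_weight m p (2 * t * (1 - t)))"

text \<open>Since 1 - 2t(1-t) = t^2 + (1-t)^2, the binomial theorem expands the integrand into
  monomials in t and 1-t, each with a Beta integral.\<close>

lemma sum_eq_crossing_integral:
  assumes "p \<le> m"
  shows "(\<Sum>k\<le>m - p. 2 ^ p * real (m choose p) * real (m - p choose k) *
       (fact (p + 2 * k) * fact (p + 2 * (m - p - k)) / fact (2 * m + 1))) = crossing_integral m p"
proof -
  let ?c = "\<lambda>k. 2 ^ p * real (m choose p) * real (m - p choose k)"
  have eq: "binomial_weight m p (2 * t * (1 - t)) =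
      (\<Sum>k\<le>m - p. ?c k * (t ^ (p + 2 * k) * (1 - t) ^ (p + 2 * (m - p - k))))" for t
  proof -
    have "1 - 2 * t * (1 - t) = t\<^sup>2 + (1 - t)\<^sup>2"
      by (simp add: power2_eq_square algebra_simps)
    then have "binomial_weight m p (2 * t * (1 - t)) =
        real (m choose p) * (2 * t * (1 - t)) ^ p * (t\<^sup>2 + (1 - t)\<^sup>2) ^ (m - p)"
      by (simp only: binomial_weight_def)
    also have "(2 * t * (1 - t)) ^ p = 2 ^ p * t ^ p * (1 - t) ^ p"
      by (simp only: power_mult_distrib)
    finally show ?thesis
      unfolding binomial_ring sum_distrib_left power_add power_mult by (simp only: mult_ac)
  qed
  have "((\<lambda>t. \<Sum>k\<le>m - p. ?c k * (t ^ (p + 2 * k) * (1 - t) ^ (p + 2 * (m - p - k)))) has_integral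
      (\<Sum>k\<le>m - p. ?c k * (fact (p + 2 * k) * fact (p + 2 * (m - p - k)) /
         fact ((p + 2 * k) + (p + 2 * (m - p - k)) + 1)))) {0..1}"
    by (intro has_integral_sum has_integral_mult_right has_integral_power_mult_power) auto
  also have "(\<Sum>k\<le>m - p. ?c k * (fact (p + 2 * k) * fact (p + 2 * (m - p - k)) /
         fact ((p + 2 * k) + (p + 2 * (m - p - k)) + 1))) =
      (\<Sum>k\<le>m - p. ?c k * (fact (p + 2 * k) * fact (p + 2 * (m - p - k)) / fact (2 * m + 1)))"
  proof (rule sum.cong)
    fix k assume "k \<in> {..m - p}"
    then have "(p + 2 * k) + (p + 2 * (m - p - k)) + 1 = 2 * m + 1" using assms by auto
    then show "?c k * (fact (p + 2 * k) * fact (p + 2 * (m - p - k)) /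
         fact ((p + 2 * k) + (p + 2 * (m - p - k)) + 1)) =
        ?c k * (fact (p + 2 * k) * fact (p + 2 * (m - p - k)) / fact (2 * m + 1))"
      by (simp only:)
  qed simp
  finally show ?thesis
    unfolding crossing_integral_def eq by (rule integral_unique[symmetric])
qed

lemma crossing_integral_nonneg: "0 \<le> crossing_integral m p"
  unfolding crossing_integral_def
  by (intro integral_nonneg integrable_continuous_interval continuous_intros binomial_weight_nonneg)
    (use two_t_one_minus_t in \<open>force+\<close>)

text \<open>As 2t(1-t) never exceeds 1/2, the Hoeffding bound holds uniformly in t.\<close>

lemma crossing_integral_tail:
  assumes "0 < m" "p \<le> m" "0 \<le> \<delta>" "1 / 2 + \<delta> \<le> real p / real m"
  shows "crossing_integral m p \<le> 2 * exp (-2 * real m * \<delta>\<^sup>2)"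
proof -
  have "crossing_integral m p \<le> integral {0..1} (\<lambda>t::real. 2 * exp (-2 * real m * \<delta>\<^sup>2))"
    unfolding crossing_integral_def
  proof (rule integral_le)
    fix t :: real assume "t \<in> {0..1}"
    with two_t_one_minus_t[of t] have "0 \<le> 2 * t * (1 - t)" "2 * t * (1 - t) \<le> 1 / 2" by auto
    then show "binomial_weight m p (2 * t * (1 - t)) \<le> 2 * exp (-2 * real m * \<delta>\<^sup>2)"
      using assms by (intro binomial_weight_tail) auto
  qed (auto intro!: integrable_continuous_interval continuous_intros)
  then show ?thesis by simp
qed

subsection \<open>Asymptotics\<close>

text \<open>The gap \<delta> may depend on \<open>m\<close>: it is constant for x > 1/2 and shrinks
  for x = 1/2.\<close>

lemma tendsto_crossing_integral_upper:
  fixes p :: "nat \<Rightarrow> nat" and \<delta> :: "nat \<Rightarrow> real"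
  assumes "\<And>m. p m \<le> m"
    and "\<forall>\<^sub>F m in sequentially. 0 \<le> \<delta> m \<and> 1 / 2 + \<delta> m \<le> real (p m) / real m"
    and "(\<lambda>m. real m * exp (-2 * real m * (\<delta> m)\<^sup>2)) \<longlonglongrightarrow> 0"
  shows "(\<lambda>m. real m * crossing_integral m (p m)) \<longlonglongrightarrow> 0"
proof (rule tendsto_sandwich)
  show "\<forall>\<^sub>F m in sequentially. 0 \<le> real m * crossing_integral m (p m)"
    by (simp add: crossing_integral_nonneg)
  show "\<forall>\<^sub>F m in sequentially. real m * crossing_integral m (p m)
      \<le> 2 * (real m * exp (-2 * real m * (\<delta> m)\<^sup>2))"
    using assms(2) eventually_gt_at_top[of 0]
  proof eventually_elim
    case (elim m)
    then have "crossing_integral m (p m) \<le> 2 * exp (-2 * real m * (\<delta> m)\<^sup>2)"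
      using assms(1) by (intro crossing_integral_tail) auto
    then show ?case by (simp add: mult_left_mono mult.left_commute)
  qed
  show "(\<lambda>m. 2 * (real m * exp (-2 * real m * (\<delta> m)\<^sup>2))) \<longlonglongrightarrow> 0"
    using tendsto_mult_left[OF assms(3), of 2] by simp
qed simp

lemma exp_decay:
  fixes \<delta> :: real
  assumes "0 < \<delta>"
  shows "(\<lambda>m. real m * exp (-2 * real m * \<delta>\<^sup>2)) \<longlonglongrightarrow> 0"
proof -
  have "0 < \<delta>\<^sup>2" using assms by simp
  then show ?thesis by real_asymp
qed

text \<open>The integral over [0, 1] is 1/(m+1), and the part over [1/2, 1] is exponentially small
  because \<open>p m / m\<close> eventually stays below 1/2 by a fixed margin.\<close>

lemma tendsto_integral_lower_half:
  fixes p :: "nat \<Rightarrow> nat"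
  assumes p: "\<And>m. p m \<le> m" and lim: "(\<lambda>m. real (p m) / real m) \<longlonglongrightarrow> x" and x: "x < 1 / 2"
  shows "(\<lambda>m. real m * integral {0..1/2} (binomial_weight m (p m))) \<longlonglongrightarrow> 1"
proof -
  define \<delta> where "\<delta> = (1 / 2 - x) / 2"
  have "0 < \<delta>" using x by (simp add: \<delta>_def)
  let ?b = "\<lambda>m. binomial_weight m (p m)"
  have int: "?b m integrable_on {a..b}" for m a b
    by (intro integrable_continuous_interval continuous_intros)
  have split: "integral {0..1/2} (?b m) = 1 / (real m + 1) - integral {1/2..1} (?b m)" for m
    using Henstock_Kurzweil_Integration.integral_combine[OF _ _ int, of 0 "1/2" 1 m]
      integral_binomial_weight[OF p, of m] by simp
  have small: "(\<lambda>m. real m * integral {1/2..1} (?b m)) \<longlonglongrightarrow> 0"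
  proof (rule tendsto_sandwich)
    show "\<forall>\<^sub>F m in sequentially. 0 \<le> real m * integral {1/2..1} (?b m)"
      by (intro always_eventually allI mult_nonneg_nonneg integral_nonneg int)
        (auto intro: binomial_weight_nonneg)
    have "\<forall>\<^sub>F m in sequentially. real (p m) / real m < 1 / 2 - \<delta>"
    proof (rule order_tendstoD(2)[OF lim])
      have "2 * x < 1" using x by simp
      then show "x < 1 / 2 - \<delta>" by (simp add: \<delta>_def field_simps)
    qed
    then show "\<forall>\<^sub>F m in sequentially. real m * integral {1/2..1} (?b m)
        \<le> real m * exp (-2 * real m * \<delta>\<^sup>2)"
      using eventually_gt_at_top[of 0]
    proof eventually_elim
      case (elim m)
      \<comment> \<open>The interval has length 1/2, which cancels the factor 2 of the Hoeffding
        bound.\<close>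
      have "integral {1/2..1} (?b m) \<le> integral {1/2..1} (\<lambda>_::real. 2 * exp (-2 * real m * \<delta>\<^sup>2))"
      proof (rule integral_le)
        fix u :: real assume u: "u \<in> {1/2..1}"
        show "?b m u \<le> 2 * exp (-2 * real m * \<delta>\<^sup>2)"
          using u elim p[of m] \<open>0 < \<delta>\<close> by (intro binomial_weight_tail) auto
      qed (auto intro: int)
      then show ?case by (auto intro: mult_left_mono)
    qed
  qed (use exp_decay[OF \<open>0 < \<delta>\<close>] in auto)
  have "(\<lambda>m. real m / (real m + 1) - real m * integral {1/2..1} (?b m)) \<longlonglongrightarrow> 1 - 0"
    by (intro tendsto_diff small) real_asymp
  then show ?thesis by (simp add: split algebra_simps)
qed

text \<open>The integral with weight |1-2t| / s is known, so only the error of this replacement has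
  to be bounded: by continuity near u = x and by the tail bound elsewhere.\<close>

lemma tendsto_crossing_integral_lower:
  fixes p :: "nat \<Rightarrow> nat"
  assumes p: "\<And>m. p m \<le> m" and lim: "(\<lambda>m. real (p m) / real m) \<longlonglongrightarrow> x" and x: "x < 1 / 2"
  shows "(\<lambda>m. real m * crossing_integral m (p m)) \<longlonglongrightarrow> 1 / sqrt (1 - 2 * x)"
proof -
  define s where "s = sqrt (1 - 2 * x)"
  have s: "0 < s" using x by (simp add: s_def)
  define J where "J = (\<lambda>m. real m * integral {0..1/2} (binomial_weight m (p m)))"
  have J: "J \<longlonglongrightarrow> 1"
    unfolding J_def by (rule tendsto_integral_lower_half) fact+
  have diff: "(\<lambda>m. real m * crossing_integral m (p m) - J m / s) \<longlonglongrightarrow> 0"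
  proof (rule tendstoI)
    fix e :: real assume e: "0 < e"
    \<comment> \<open>With \<open>J m < 2\<close> the main error is below e/2; the tail adds less
      than e/4.\<close>
    define \<epsilon> where "\<epsilon> = e / 4"
    have \<epsilon>: "0 < \<epsilon>" using e by (simp add: \<epsilon>_def)
    \<comment> \<open>At u = x the first term vanishes, so \<open>?h\<close> is negative nearby.
      Measuring the error against \<open>sqrt (1 - 2 * u)\<close>, which is |1-2t|, makes its
      integral a multiple of the known \<open>J m\<close>.\<close>
    let ?h = "\<lambda>u. \<bar>1 - sqrt (1 - 2 * u) / s\<bar> - \<epsilon> * sqrt (1 - 2 * u)"
    have "(?h \<longlongrightarrow> ?h x) (nhds x)"
      using s by (intro tendsto_intros tendsto_ident_at) (auto simp: filterlim_ident)
    moreover have "?h x < 0" using s \<epsilon> by (simp add: s_def)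
    ultimately have "\<forall>\<^sub>F u in nhds x. ?h u < 0" by (rule order_tendstoD)
    then obtain d where d: "0 < d" "\<And>u. \<bar>u - x\<bar> < d \<Longrightarrow> ?h u < 0"
      unfolding eventually_nhds_metric dist_real_def by blast
    \<comment> \<open>Half of \<open>d\<close> is spent on the distance from \<open>p m / m\<close>
      to \<open>x\<close>, so a \<open>u\<close> at distance at least \<open>d\<close> from
      \<open>x\<close> is still \<delta> away from \<open>p m / m\<close>.\<close>
    define \<delta> where "\<delta> = d / 2"
    have \<delta>: "0 < \<delta>" using d by (simp add: \<delta>_def)
    \<comment> \<open>The factor 2 comes from Hoeffding; \<open>1 + 1 / s\<close> bounds the
      difference of the weights, as |1-2t| \<le> 1.\<close>
    define C where "C = 2 * (1 + 1 / s)"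
    have C: "0 \<le> C" using s by (simp add: C_def)
    have "(\<lambda>m. C * (real m * exp (-2 * real m * \<delta>\<^sup>2))) \<longlonglongrightarrow> C * 0"
      by (intro tendsto_intros exp_decay \<delta>)
    then have "\<forall>\<^sub>F m in sequentially. C * (real m * exp (-2 * real m * \<delta>\<^sup>2)) < e / 4"
      by (rule order_tendstoD) (use e in simp)
    moreover have "\<forall>\<^sub>F m in sequentially. J m < 2"
      using J by (rule order_tendstoD) simp
    moreover have "\<forall>\<^sub>F m in sequentially. dist (real (p m) / real m) x < \<delta>"
      using lim \<delta> by (rule tendstoD)
    ultimately show "\<forall>\<^sub>F m in sequentially. dist (real m * crossing_integral m (p m) - J m / s) 0 < e"
      using eventually_gt_at_top[of 0]
    proof eventually_elim
      case (elim m)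
      let ?b = "\<lambda>t. binomial_weight m (p m) (2 * t * (1 - t))"
      have J_eq: "J m = real m * integral {0..1} (\<lambda>t. \<bar>1 - 2 * t\<bar> * ?b t)"
        unfolding J_def integral_abs_binomial_weight ..
      have int: "?b integrable_on {0..1}" "(\<lambda>t. \<bar>1 - 2 * t\<bar> * ?b t) integrable_on {0..1}"
        by (intro integrable_continuous_interval continuous_intros)+
      have diff_eq: "crossing_integral m (p m) - integral {0..1} (\<lambda>t. \<bar>1 - 2 * t\<bar> * ?b t) / s =
          integral {0..1} (\<lambda>t. ?b t - \<bar>1 - 2 * t\<bar> * ?b t / s)"
        unfolding crossing_integral_def using int integrable_on_divide[OF int(2), of s]
        by (subst integral_diff) auto
      have "\<bar>integral {0..1} (\<lambda>t. ?b t - \<bar>1 - 2 * t\<bar> * ?b t / s)\<bar> \<le> integral {0..1}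
          (\<lambda>t. \<epsilon> * (\<bar>1 - 2 * t\<bar> * ?b t) + C * exp (-2 * real m * \<delta>\<^sup>2))"
      proof (rule integral_norm_bound_integral[where 'a = real, unfolded real_norm_def])
        fix t :: real assume t: "t \<in> {0..1}"
        define u where "u = 2 * t * (1 - t)"
        have u: "0 \<le> u" "u \<le> 1 / 2" "sqrt (1 - 2 * u) = \<bar>1 - 2 * t\<bar>"
          using two_t_one_minus_t[of t] t by (auto simp: u_def)
        have b0: "0 \<le> ?b t" using binomial_weight_nonneg[of u] u by (simp add: u_def)
        have "\<bar>?b t - \<bar>1 - 2 * t\<bar> * ?b t / s\<bar> = \<bar>1 - \<bar>1 - 2 * t\<bar> / s\<bar> * \<bar>?b t\<bar>"
          unfolding abs_mult[symmetric] by (simp add: algebra_simps)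
        then have eq: "\<bar>?b t - \<bar>1 - 2 * t\<bar> * ?b t / s\<bar> = \<bar>1 - \<bar>1 - 2 * t\<bar> / s\<bar> * ?b t"
          using b0 by simp
        show "\<bar>?b t - \<bar>1 - 2 * t\<bar> * ?b t / s\<bar> \<le>
            \<epsilon> * (\<bar>1 - 2 * t\<bar> * ?b t) + C * exp (-2 * real m * \<delta>\<^sup>2)"
        proof (cases "\<bar>u - x\<bar> < d")
          case True
          then have "\<bar>1 - \<bar>1 - 2 * t\<bar> / s\<bar> \<le> \<epsilon> * \<bar>1 - 2 * t\<bar>"
            using d(2)[of u] u(3) by simp
          then have "\<bar>1 - \<bar>1 - 2 * t\<bar> / s\<bar> * ?b t \<le> \<epsilon> * \<bar>1 - 2 * t\<bar> * ?b t"
            using b0 by (rule mult_right_mono)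
          moreover have "0 \<le> C * exp (-2 * real m * \<delta>\<^sup>2)" using C by simp
          ultimately show ?thesis unfolding eq by (simp add: mult.assoc)
        next
          case False
          have "\<delta> \<le> \<bar>real (p m) / real m - u\<bar>"
            using False elim(3) unfolding dist_real_def \<delta>_def by argo
          then have "?b t \<le> 2 * exp (-2 * real m * \<delta>\<^sup>2)"
            unfolding u_def[symmetric] using u elim p[of m] \<delta>
            by (intro binomial_weight_tail) auto
          moreover have "\<bar>1 - \<bar>1 - 2 * t\<bar> / s\<bar> \<le> 1 + 1 / s"
          proof -
            have "\<bar>1 - 2 * t\<bar> \<le> 1" using t by auto
            then have "\<bar>1 - 2 * t\<bar> / s \<le> 1 / s" using s by (intro divide_right_mono) auto
            moreover have "0 \<le> \<bar>1 - 2 * t\<bar> / s" using s by simp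
            ultimately show ?thesis by argo
          qed
          ultimately have "\<bar>1 - \<bar>1 - 2 * t\<bar> / s\<bar> * ?b t \<le> (1 + 1 / s) * (2 * exp (-2 * real m * \<delta>\<^sup>2))"
            using b0 s by (intro mult_mono) auto
          moreover have "0 \<le> \<epsilon> * (\<bar>1 - 2 * t\<bar> * ?b t)" using \<epsilon> b0 by simp
          moreover have "(1 + 1 / s) * (2 * exp (-2 * real m * \<delta>\<^sup>2)) = C * exp (-2 * real m * \<delta>\<^sup>2)"
            by (simp only: C_def mult_ac)
          ultimately show ?thesis unfolding eq by linarith
        qed
      next
        show "(\<lambda>t. ?b t - \<bar>1 - 2 * t\<bar> * ?b t / s) integrable_on {0..1}"
          by (intro integrable_diff integrable_on_divide int)
        show "(\<lambda>t. \<epsilon> * (\<bar>1 - 2 * t\<bar> * ?b t) + C * exp (-2 * real m * \<delta>\<^sup>2)) integrable_on {0..1}"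
          by (intro integrable_add integrable_on_mult_right int integrable_const_ivl)
      qed
      also have "\<dots> = \<epsilon> * integral {0..1} (\<lambda>t. \<bar>1 - 2 * t\<bar> * ?b t) + C * exp (-2 * real m * \<delta>\<^sup>2)"
        using integrable_on_mult_right[OF int(2), of \<epsilon>] by (subst integral_add) auto
      finally have "\<bar>crossing_integral m (p m) - integral {0..1} (\<lambda>t. \<bar>1 - 2 * t\<bar> * ?b t) / s\<bar>
          \<le> \<epsilon> * integral {0..1} (\<lambda>t. \<bar>1 - 2 * t\<bar> * ?b t) + C * exp (-2 * real m * \<delta>\<^sup>2)"
        unfolding diff_eq .
      then have "real m * \<bar>crossing_integral m (p m) - integral {0..1} (\<lambda>t. \<bar>1 - 2 * t\<bar> * ?b t) / s\<bar>
          \<le> real m * (\<epsilon> * integral {0..1} (\<lambda>t. \<bar>1 - 2 * t\<bar> * ?b t) + C * exp (-2 * real m * \<delta>\<^sup>2))"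
        by (rule mult_left_mono) simp
      also have "\<dots> = \<epsilon> * J m + C * (real m * exp (-2 * real m * \<delta>\<^sup>2))"
        by (simp add: J_eq algebra_simps)
      also have "\<dots> < \<epsilon> * 2 + e / 4"
        using elim \<epsilon> by (intro add_strict_mono mult_strict_left_mono) auto
      also have "\<dots> < e" using e by (simp add: \<epsilon>_def)
      finally show ?case
        unfolding dist_real_def J_eq
        by (simp only: diff_zero abs_mult abs_of_nat times_divide_eq_right[symmetric]
            right_diff_distrib[symmetric])
    qed
  qed
  have "(\<lambda>m. (real m * crossing_integral m (p m) - J m / s) + J m / s) \<longlonglongrightarrow> 0 + 1 / s"
    using s by (intro tendsto_intros diff J) auto
  then show ?thesis by (simp add: s_def)
qed

text \<open>The exponent is -2 m^(2c-1), and 2c-1 is positive.\<close>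

lemma powr_exp_decay:
  assumes "1 / 2 < c"
  shows "(\<lambda>m. real m * exp (-2 * real m * (real m powr (c - 1))\<^sup>2)) \<longlonglongrightarrow> 0"
proof (rule Lim_transform_eventually)
  have "0 < 2 * c - 1" using assms by simp
  then show "(\<lambda>m. real m * exp (-2 * real m powr (2 * c - 1))) \<longlonglongrightarrow> 0"
    by real_asymp
  show "\<forall>\<^sub>F m in sequentially. real m * exp (-2 * real m powr (2 * c - 1)) =
      real m * exp (-2 * real m * (real m powr (c - 1))\<^sup>2)"
    using eventually_gt_at_top[of 0]
  proof eventually_elim
    case (elim m)
    then have "real m powr (2 * c - 1) = real m powr 1 * (real m powr (c - 1) * real m powr (c - 1))"
      unfolding powr_add[symmetric] by simp
    with elim show ?case by (simp add: power2_eq_square)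
  qed
qed

text \<open>At x = 1/2 the tail bound needs a quantitative excess of p/(n-1) over 1/2. The assumed
  margin, after division by m = n-1, is \<delta> = m^(c-1), for which m \<delta>^2 tends to
  infinity.\<close>

theorem theorem11:
  fixes x :: real and p :: "nat \<Rightarrow> nat"
  assumes "0 \<le> x" and "x \<le> 1"
    and "\<And>n. 1 \<le> n \<Longrightarrow> p n \<le> n - 1"
    and "(\<lambda>n. real (p n) / (real n - 1)) \<longlonglongrightarrow> x"
    and "x = 1 / 2 \<Longrightarrow>
           \<exists>c > 1 / 2. \<forall>\<^sub>F n in sequentially.
             real (p n) \<ge> (real n - 1) / 2 + (real n - 1) powr c"
  shows "(\<lambda>n. (real n - 1) * K_prob n (p n))
           \<longlonglongrightarrow> (if x < 1 / 2 then 1 / sqrt (1 - 2 * x) else 0)"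
proof -
  \<comment> \<open>The shift n = m + 1 turns n - 1 into \<open>m\<close> and skips n = 0, where
    \<open>p\<close> is unconstrained.\<close>
  define q where "q = (\<lambda>m. p (Suc m))"
  have q: "q m \<le> m" for m using assms(3)[of "Suc m"] by (simp add: q_def)
  have lim: "(\<lambda>m. real (q m) / real m) \<longlonglongrightarrow> x"
    using LIMSEQ_Suc[OF assms(4)] by (simp add: q_def)
  have K: "K_prob (Suc m) (q m) = crossing_integral m (q m)" for m
    unfolding K_prob_Suc[OF q] by (rule sum_eq_crossing_integral[OF q])
  consider "x < 1 / 2" | "x = 1 / 2" | "1 / 2 < x" by linarith
  then have "(\<lambda>m. real m * crossing_integral m (q m))
      \<longlonglongrightarrow> (if x < 1 / 2 then 1 / sqrt (1 - 2 * x) else 0)"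
  proof cases
    case 1
    with tendsto_crossing_integral_lower[OF q lim] show ?thesis by simp
  next
    case 2
    then obtain c where c: "1 / 2 < c" and
      ev: "\<forall>\<^sub>F n in sequentially. real (p n) \<ge> (real n - 1) / 2 + (real n - 1) powr c"
      using assms(5) by blast
    have ev': "\<forall>\<^sub>F m in sequentially. real (q m) \<ge> real m / 2 + real m powr c"
      using ev eventually_sequentially_Suc[of "\<lambda>n. real (p n) \<ge> (real n - 1) / 2 + (real n - 1) powr c"]
      by (simp add: q_def)
    have "(\<lambda>m. real m * crossing_integral m (q m)) \<longlonglongrightarrow> 0"
    proof (rule tendsto_crossing_integral_upper[OF q _ powr_exp_decay[OF c]])
      show "\<forall>\<^sub>F m in sequentially. 0 \<le> real m powr (c - 1) \<and>
          1 / 2 + real m powr (c - 1) \<le> real (q m) / real m"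
        using ev' eventually_gt_at_top[of 0]
      proof eventually_elim
        case (elim m)
        then have "(real m / 2 + real m powr c) / real m \<le> real (q m) / real m"
          by (intro divide_right_mono) auto
        moreover have "(real m / 2 + real m powr c) / real m = 1 / 2 + real m powr (c - 1)"
          using elim by (simp add: powr_diff add_divide_distrib)
        ultimately show ?case by simp
      qed
    qed
    with 2 show ?thesis by simp
  next
    case 3
    \<comment> \<open>Half the distance from \<open>x\<close> to 1/2, so that \<open>q m / m\<close>
      eventually exceeds 1/2 + \<delta>.\<close>
    define \<delta> where "\<delta> = (x - 1 / 2) / 2"
    have \<delta>: "0 < \<delta>" "1 / 2 + \<delta> < x" using 3 by (auto simp: \<delta>_def field_simps)
    have "(\<lambda>m. real m * crossing_integral m (q m)) \<longlonglongrightarrow> 0"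
    proof (rule tendsto_crossing_integral_upper[OF q _ exp_decay[OF \<delta>(1)]])
      show "\<forall>\<^sub>F m in sequentially. 0 \<le> \<delta> \<and> 1 / 2 + \<delta> \<le> real (q m) / real m"
        using order_tendstoD(1)[OF lim \<delta>(2)] by eventually_elim (use \<delta>(1) in auto)
    qed
    with 3 show ?thesis by simp
  qed
  then have "(\<lambda>m. (real (Suc m) - 1) * K_prob (Suc m) (p (Suc m)))
      \<longlonglongrightarrow> (if x < 1 / 2 then 1 / sqrt (1 - 2 * x) else 0)"
    by (simp add: K[unfolded q_def] q_def)
  then show ?thesis by (rule LIMSEQ_imp_Suc)
qed

end
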